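(* Let $(X,d)$ be a nonempty ultrametric space and, for each fixed $r_1>0$, let $$\mathbf{B}_X^{r_1}=\{B_{r_1}(c): c\in X\}$$ be the set of all open balls in $(X,d)$ of radius $r_1$. Then the following conditions are equivalent: (i) The set $\mathbf{B}_X^{r_1}$ is finite for every $r_1>0$. (ii) $(X,d)$ is totally bounded.
   Context: An ultrametric on $X$ is a metric $d$ with $d(x,y)\leq\max\{d(x,z),d(z,y)\}$ for all $x,y,z\in X$. The open ball with radius $r>0$ and center $c\in X$ is $B_r(c)=\{x\in X:d(c,x)<r\}$; $\mathbf{B}_X^{r_1}$ is a set of subsets of $X$ (balls with different centers that coincide as sets are counted once). A metric space is totally bounded if for every $r>0$ there are finitely many open balls of radius $r$, with centers in $X$, covering $X$. *)

theory Defs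
  imports "HOL-Analysis.Analysis"
begin

(* Metric_space requires nonnegativity and symmetry of d on the whole type, not only on the
   carrier M. This loses no generality: a metric given on M only can be set to 0 elsewhere. *)
locale Ultrametric_space = Metric_space +
  assumes ultrametric:
    "\<And>x y z. \<lbrakk>x \<in> M; y \<in> M; z \<in> M\<rbrakk> \<Longrightarrow> d x y \<le> max (d x z) (d z y)"

(* A set of subsets of M, so centers with the same ball contribute a single element. *)
definition (in Metric_space) open_balls :: "real \<Rightarrow> 'a set set" where
  "open_balls r = {mball c r | c. c \<in> M}"

end

(* In an ultrametric space every point of a ball is a center of it, so a finite cover of X by balls
   of radius r already contains every ball of radius r. *)
theory Submission
  imports Defs
begin

text \<open>For fixed r > 0 the balls of radius r partition X: by \<open>mball_eq_mball\<close>, a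
  ball equals the ball of the same radius about any of its points. If finitely many blocks of a
  partition cover X, there are no others. Conversely, when there are only finitely many balls,
  picking a center for each gives a finite cover.\<close>

context Ultrametric_space
begin

text \<open>Going from y to z through x, the larger of two distances below r bounds
  \<open>d y z\<close>; an ordinary triangle inequality would only give 2r.\<close>

lemma mball_subset_mball:
  assumes "y \<in> mball x r"
  shows "mball x r \<subseteq> mball y r"
proof
  fix z
  assume z: "z \<in> mball x r"
  have "d y z \<le> max (d y x) (d x z)"
    using assms z by (intro ultrametric) auto
  with assms z show "z \<in> mball y r"
    by (simp add: commute[of y x] max_def split: if_splits)
qed

text \<open>Lying within r of each other is symmetric in x and y, so the inclusion applies in both
  directions.\<close>

lemma mball_eq_mball:
  assumes "y \<in> mball x r"
  shows "mball y r = mball x r"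
proof -
  have "x \<in> mball y r"
    using assms by (simp add: commute[of y x])
  with assms show ?thesis
    by (intro subset_antisym mball_subset_mball)
qed

lemma mtotally_bounded_if_finite_open_balls:
  assumes fin: "\<And>r. r > 0 \<Longrightarrow> finite (open_balls r)"
  shows "mtotally_bounded M"
  unfolding mtotally_bounded_def
proof (intro allI impI)
  fix r :: real
  assume "r > 0"
  have "finite ((\<lambda>c. mball c r) ` M)"
    using fin[OF \<open>r > 0\<close>] by (simp add: open_balls_def Setcompr_eq_image)
  \<comment> \<open>X may be infinite although its balls are finitely many; finitely many centers K
    already produce all of them.\<close>
  from finite_subset_image[OF this subset_refl]
  obtain K where K: "K \<subseteq> M" "finite K" "(\<lambda>c. mball c r) ` M = (\<lambda>c. mball c r) ` K"
    by (elim exE conjE)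
  have "M \<subseteq> (\<Union>c\<in>M. mball c r)"
    using \<open>r > 0\<close> by auto
  then show "\<exists>K. finite K \<and> K \<subseteq> M \<and> M \<subseteq> (\<Union>x\<in>K. mball x r)"
    using K by (intro exI[of _ K]) simp
qed

lemma finite_open_balls_if_mtotally_bounded:
  assumes "mtotally_bounded M" and "r > 0"
  shows "finite (open_balls r)"
proof -
  obtain K where "finite K" and cover: "M \<subseteq> (\<Union>x\<in>K. mball x r)"
    using assms by (auto simp: mtotally_bounded_def)
  have "open_balls r \<subseteq> (\<lambda>x. mball x r) ` K"
  proof
    fix B
    assume "B \<in> open_balls r"
    then obtain c where "c \<in> M" and B: "B = mball c r"
      by (auto simp: open_balls_def)
    \<comment> \<open>It suffices to locate the center c in the cover: the covering ball that
      contains c is then B itself.\<close>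
    then obtain x where "x \<in> K" "c \<in> mball x r"
      using cover by blast
    then show "B \<in> (\<lambda>x. mball x r) ` K"
      using B mball_eq_mball by blast
  qed
  with \<open>finite K\<close> show ?thesis
    by (simp add: finite_surj)
qed

end

theorem proposition2p3:
  fixes X :: "'a set" and d :: "'a \<Rightarrow> 'a \<Rightarrow> real"
  assumes "Ultrametric_space X d" and "X \<noteq> {}"
  shows "(\<forall>r\<^sub>1>0. finite (Metric_space.open_balls X d r\<^sub>1)) \<longleftrightarrow>
    Metric_space.mtotally_bounded X d X"
proof -
  interpret Ultrametric_space X d by fact
  show ?thesis
    using mtotally_bounded_if_finite_open_balls finite_open_balls_if_mtotally_bounded by blast
qed

end
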